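(* Let $(P_0,P_1,\dots,P_m)$ be a Clifford system on $\mathbb{R}^{2l}$, i.e. $P_0,\dots,P_m\in O(2l)$ are real symmetric orthogonal matrices satisfying $P_iP_j+P_jP_i=2\delta_{ij}I_{2l}$ for all $i,j$. Let $B_1,\dots,B_M\in\mathrm{span}\{P_0,P_1,\dots,P_m\}$ (real span). Then $$\sum_{r,s=1}^M\|[B_r,B_s]\|^2\le\frac2l\left(1-\frac1N\right)\left(\sum_{r=1}^M\|B_r\|^2\right)^2,\qquad N=\min\{m+1,M\}.$$ The condition for equality has two cases. Case (1): When $m+1\le M$, equality holds if and only if $p_0,\dots,p_m$ are pairwise orthogonal vectors with the same norm, where $p_i:=(\langle P_i,B_1\rangle,\dots,\langle P_i,B_M\rangle)\in\mathbb{R}^M$. Case (2): When $m+1\ge M$, equality holds if and only if $B_1,\dots,B_M$ are pairwise orthogonal with respect to $\langle\cdot,\cdot\rangle$ and have the same Frobenius norm.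
   Context: $[A,B]=AB-BA$; for real matrices $\langle A,B\rangle=\mathrm{tr}(AB^t)$ is the Frobenius inner product and $\|A\|^2=\langle A,A\rangle$. $O(2l)$ is the group of real orthogonal $2l\times 2l$ matrices, $I_{2l}$ the identity matrix, $\delta_{ij}$ the Kronecker delta. Here $l,m,M$ are positive integers. *)

theory Defs
  imports "HOL-Analysis.Analysis"
begin

definition commutator :: "real^'n^'n \<Rightarrow> real^'n^'n \<Rightarrow> real^'n^'n"
  where "commutator A B = A ** B - B ** A"

definition frob_inner :: "real^'n^'n \<Rightarrow> real^'n^'n \<Rightarrow> real"
  where "frob_inner A B = trace (A ** transpose B)"

definition frob_norm :: "real^'n^'n \<Rightarrow> real"
  where "frob_norm A = sqrt (frob_inner A A)"

lemma frob_inner_eq_inner: "frob_inner A B = A \<bullet> B"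
  by (simp add: frob_inner_def trace_def matrix_matrix_mult_def transpose_def inner_vec_def)

lemma frob_norm_eq_norm: "frob_norm A = norm A"
  by (simp add: frob_norm_def frob_inner_eq_inner norm_eq_sqrt_inner)

text \<open>Only the values \<open>P 0, \<dots>, P m\<close> matter. The ambient space is \<open>real^'n\<close>; in a
  Clifford system on \<open>\<real>\<^sup>2\<^sup>l\<close> the cardinality of \<open>'n\<close> is \<open>2 * l\<close>.\<close>

definition clifford_system :: "nat \<Rightarrow> (nat \<Rightarrow> real^'n^'n) \<Rightarrow> bool"
  where "clifford_system m P \<longleftrightarrow>
    (\<forall>i\<le>m. orthogonal_matrix (P i) \<and> transpose (P i) = P i) \<and>
    (\<forall>i\<le>m. \<forall>j\<le>m. P i ** P j + P j ** P i = (if i = j then 2 else 0) *\<^sub>R mat 1)"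

end

theory Submission
  imports Defs
begin

text \<open>The Clifford relations extend bilinearly to the anticommutator identity
  \<open>AB + BA = (\<langle>A, B\<rangle> / l) I\<close> on the span. By the parallelogram law this gives
  \<open>\<parallel>[A, B]\<parallel>\<^sup>2 = (2 / l) (\<parallel>A\<parallel>\<^sup>2 \<parallel>B\<parallel>\<^sup>2 - \<langle>A, B\<rangle>\<^sup>2)\<close>, so the claim amounts to
  \<open>\<parallel>G\<parallel>\<^sup>2 \<ge> (tr G)\<^sup>2 / N\<close> for the Gram matrix \<open>G\<close> of the \<open>B\<^sub>r\<close>. For an \<open>n \<times> n\<close> matrix,
  \<open>\<parallel>G\<parallel>\<^sup>2 - (tr G)\<^sup>2 / n\<close> is the squared norm of \<open>G - (tr G / n) I\<close>. Since \<open>P\<^sub>i / \<surd>(2l)\<close> is an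
  orthonormal basis of the span, the Gram matrix of the \<open>p\<^sub>i\<close> has, up to the factor \<open>2l\<close>, the same
  trace and the same norm as \<open>G\<close>; using the smaller of the two Gram matrices gives the bound
  with \<open>N = min (m + 1) M\<close>, together with the equality cases.\<close>

section \<open>Gram matrices of finite families\<close>

lemma sum_sq_minus_trace_sq:
  fixes g :: "'i \<Rightarrow> 'i \<Rightarrow> real"
  assumes "finite I" "I \<noteq> {}"
  defines "t \<equiv> \<Sum>i\<in>I. g i i"
  shows "(\<Sum>i\<in>I. \<Sum>j\<in>I. (g i j)\<^sup>2) - t\<^sup>2 / card I
    = (\<Sum>i\<in>I. \<Sum>j\<in>I. (g i j - (if i = j then t / card I else 0))\<^sup>2)"
proof -
  define n where "n = real (card I)"
  have n: "n > 0" using assms by (simp add: n_def card_gt_0_iff)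
  have "(\<Sum>i\<in>I. \<Sum>j\<in>I. (g i j - (if i = j then t / n else 0))\<^sup>2)
      = (\<Sum>i\<in>I. \<Sum>j\<in>I. (g i j)\<^sup>2 + (if i = j then (t / n)\<^sup>2 - 2 * (t / n) * g i i else 0))"
    by (intro sum.cong refl) (auto simp: power2_diff)
  also have "\<dots> = (\<Sum>i\<in>I. \<Sum>j\<in>I. (g i j)\<^sup>2) + (\<Sum>i\<in>I. (t / n)\<^sup>2 - 2 * (t / n) * g i i)"
    using assms(1) by (simp add: sum.distrib)
  also have "(\<Sum>i\<in>I. (t / n)\<^sup>2 - 2 * (t / n) * g i i) = n * (t / n)\<^sup>2 - 2 * (t / n) * t"
    by (simp only: sum_subtractf sum_distrib_left[symmetric] sum_constant n_def t_def)
  also have "\<dots> = - (t\<^sup>2 / n)"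
    using n by (simp add: field_simps power2_eq_square)
  finally show ?thesis unfolding n_def by simp
qed

text \<open>The inner product space is left general because this serves both families: the matrices
  \<open>B r\<close> and the vectors \<open>p i\<close>. In the equality case every
  \<open>d i j\<close> vanishes: off the diagonal this is orthogonality, on the diagonal it makes
  each squared norm equal to the mean \<open>t / card I\<close>.\<close>

lemma gram_norm_bound:
  fixes v :: "'i \<Rightarrow> 'a::real_inner"
  assumes I: "finite I" "I \<noteq> {}"
  shows "(\<Sum>i\<in>I. (norm (v i))\<^sup>2)\<^sup>2 / card I \<le> (\<Sum>i\<in>I. \<Sum>j\<in>I. (v i \<bullet> v j)\<^sup>2)"
    and "(\<Sum>i\<in>I. \<Sum>j\<in>I. (v i \<bullet> v j)\<^sup>2) = (\<Sum>i\<in>I. (norm (v i))\<^sup>2)\<^sup>2 / card I \<longleftrightarrow>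
      (\<forall>i\<in>I. \<forall>j\<in>I. i \<noteq> j \<longrightarrow> orthogonal (v i) (v j)) \<and>
      (\<forall>i\<in>I. \<forall>j\<in>I. norm (v i) = norm (v j))"
proof -
  define t where "t = (\<Sum>i\<in>I. (norm (v i))\<^sup>2)"
  define d where "d i j = (v i \<bullet> v j - (if i = j then t / card I else 0))\<^sup>2" for i j
  have eq: "(\<Sum>i\<in>I. \<Sum>j\<in>I. (v i \<bullet> v j)\<^sup>2) - t\<^sup>2 / card I = (\<Sum>i\<in>I. \<Sum>j\<in>I. d i j)"
    unfolding t_def d_def power2_norm_eq_inner by (rule sum_sq_minus_trace_sq[OF I])
  have nonneg: "d i j \<ge> 0" for i j by (simp add: d_def)
  show "(\<Sum>i\<in>I. (norm (v i))\<^sup>2)\<^sup>2 / card I \<le> (\<Sum>i\<in>I. \<Sum>j\<in>I. (v i \<bullet> v j)\<^sup>2)"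
  proof -
    have "0 \<le> (\<Sum>i\<in>I. \<Sum>j\<in>I. d i j)" by (intro sum_nonneg nonneg)
    then show ?thesis using eq unfolding t_def by linarith
  qed
  have "(\<Sum>i\<in>I. \<Sum>j\<in>I. (v i \<bullet> v j)\<^sup>2) = t\<^sup>2 / card I \<longleftrightarrow> (\<Sum>i\<in>I. \<Sum>j\<in>I. d i j) = 0"
    using eq by linarith
  also have "\<dots> \<longleftrightarrow> (\<forall>i\<in>I. \<forall>j\<in>I. d i j = 0)"
    using I(1) nonneg by (simp add: sum_nonneg_eq_0_iff sum_nonneg)
  also have "\<dots> \<longleftrightarrow> (\<forall>i\<in>I. \<forall>j\<in>I. i \<noteq> j \<longrightarrow> orthogonal (v i) (v j)) \<and>
      (\<forall>i\<in>I. (norm (v i))\<^sup>2 = t / card I)"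
    by (auto simp: d_def orthogonal_def power2_norm_eq_inner)
  also have "(\<forall>i\<in>I. (norm (v i))\<^sup>2 = t / card I) \<longleftrightarrow> (\<forall>i\<in>I. \<forall>j\<in>I. norm (v i) = norm (v j))"
  proof
    assume "\<forall>i\<in>I. (norm (v i))\<^sup>2 = t / card I"
    then show "\<forall>i\<in>I. \<forall>j\<in>I. norm (v i) = norm (v j)"
      by (metis norm_ge_zero power2_eq_iff_nonneg)
  next
    assume *: "\<forall>i\<in>I. \<forall>j\<in>I. norm (v i) = norm (v j)"
    show "\<forall>i\<in>I. (norm (v i))\<^sup>2 = t / card I"
    proof
      fix i assume "i \<in> I"
      then have "norm (v j) = norm (v i)" if "j \<in> I" for j
        using * that by blast
      then have "t = (\<Sum>j\<in>I. (norm (v i))\<^sup>2)"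
        unfolding t_def by simp
      then show "(norm (v i))\<^sup>2 = t / card I" using I by simp
    qed
  qed
  finally show "(\<Sum>i\<in>I. \<Sum>j\<in>I. (v i \<bullet> v j)\<^sup>2) = (\<Sum>i\<in>I. (norm (v i))\<^sup>2)\<^sup>2 / card I \<longleftrightarrow>
      (\<forall>i\<in>I. \<forall>j\<in>I. i \<noteq> j \<longrightarrow> orthogonal (v i) (v j)) \<and>
      (\<forall>i\<in>I. \<forall>j\<in>I. norm (v i) = norm (v j))"
    by (simp add: t_def)
qed

lemma matrix_inner_eq_trace: "A \<bullet> B = trace (A ** transpose B)"
  for A B :: "real^'n^'n"
  using frob_inner_eq_inner[of A B] by (simp add: frob_inner_def)

lemma matrix_add_rdistrib: "(A + B) ** C = A ** C + B ** C"
  for A B :: "'a::semiring_1^'m^'n"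
  by (simp add: matrix_matrix_mult_def vec_eq_iff distrib_right sum.distrib)

lemma trace_scaleR: "trace (c *\<^sub>R A) = c * trace A" for A :: "real^'n^'n"
  by (simp add: trace_def sum_distrib_left)

lemma inner_mat_1_self: "(mat 1 :: real^'n^'n) \<bullet> mat 1 = CARD('n)"
  by (simp add: matrix_inner_eq_trace trace_I)

section \<open>The span of a Clifford system\<close>

lemma clifford_transpose:
  assumes "clifford_system m P" "A \<in> span (P ` {0..m})"
  shows "transpose A = A"
  using assms(2)
proof (induction rule: span_induct)
  case base
  show ?case
    by (auto simp: subspace_def transpose_def vec_eq_iff)
next
  case (step A)
  then show ?case using assms(1) by (auto simp: clifford_system_def)
qed

text \<open>Take the trace of the Clifford relation: both products have the same trace, and by
  symmetry of \<open>P j\<close> that trace is the inner product.\<close>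

lemma clifford_inner:
  fixes P :: "nat \<Rightarrow> real^'n^'n"
  assumes "clifford_system m P" "i \<le> m" "j \<le> m"
  shows "P i \<bullet> P j = (if i = j then CARD('n) else 0)"
proof -
  have "2 * (P i \<bullet> P j) = trace (P i ** P j + P j ** P i)"
    using assms trace_mul_sym[of "P i" "P j"]
    unfolding trace_add by (simp add: matrix_inner_eq_trace clifford_system_def)
  also have "\<dots> = trace ((if i = j then 2 else 0) *\<^sub>R (mat 1 :: real^'n^'n))"
    using assms by (simp add: clifford_system_def)
  also have "\<dots> = (if i = j then 2 else 0) * real CARD('n)"
    by (simp only: trace_scaleR trace_I)
  finally show ?thesis by (simp split: if_splits)
qed

text \<open>Fourier expansion in the orthogonal family \<open>P i\<close>, whose squared norms are
  \<open>CARD('n)\<close>. The matrices fixed by the linear map \<open>f\<close> form a subspace, so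
  checking the generators is enough.\<close>

lemma clifford_expansion:
  fixes P :: "nat \<Rightarrow> real^'n^'n"
  assumes "clifford_system m P" "A \<in> span (P ` {0..m})"
  shows "A = (\<Sum>i\<in>{0..m}. ((P i \<bullet> A) / CARD('n)) *\<^sub>R P i)"
  using assms(2)
proof (induction rule: span_induct)
  case base
  define f where "f X = (\<Sum>i\<in>{0..m}. ((P i \<bullet> X) / CARD('n)) *\<^sub>R P i)" for X
  have "linear f"
    by (rule linearI) (simp_all add: f_def inner_add_right add_divide_distrib scaleR_add_left
        sum.distrib scaleR_sum_right)
  then have "subspace {X. X = f X}"
    by (simp add: subspace_def linear_0 linear_add linear_scale)
  then show ?case by (simp add: f_def)
next
  case (step A)
  then obtain j where j: "A = P j" "j \<le> m" by auto
  have "(\<Sum>i\<in>{0..m}. ((P i \<bullet> A) / CARD('n)) *\<^sub>R P i)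
      = (\<Sum>i\<in>{0..m}. if i = j then P j else 0)"
    using j assms(1) by (intro sum.cong) (auto simp: clifford_inner)
  then show ?case using j by simp
qed

lemma clifford_parseval:
  fixes P :: "nat \<Rightarrow> real^'n^'n"
  assumes "clifford_system m P" "A \<in> span (P ` {0..m})"
  shows "A \<bullet> B = (\<Sum>i\<in>{0..m}. (P i \<bullet> A) * (P i \<bullet> B)) / CARD('n)"
  by (subst clifford_expansion[OF assms]) (simp add: inner_sum_left sum_divide_distrib)

text \<open>The defect \<open>f\<close> is bilinear and symmetric, and it vanishes on pairs of
  generators. Vanishing passes to the span one argument at a time, with symmetry reducing the second
  argument to the first.\<close>

lemma clifford_anticommutator:
  fixes P :: "nat \<Rightarrow> real^'n^'n"
  assumes P: "clifford_system m P"
    and A: "A \<in> span (P ` {0..m})" and B: "B \<in> span (P ` {0..m})"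
  shows "A ** B + B ** A = (2 * (A \<bullet> B) / CARD('n)) *\<^sub>R mat 1"
proof -
  define f where "f X Y = X ** Y + Y ** X - (2 * (X \<bullet> Y) / CARD('n)) *\<^sub>R mat 1"
    for X Y :: "real^'n^'n"
  have linear: "linear (\<lambda>X. f X Y)" for Y
    unfolding f_def
    by (rule linearI)
      (simp_all add: matrix_add_ldistrib matrix_add_rdistrib inner_add_left distrib_left
        add_divide_distrib scaleR_add_left matrix_scalar_ac scalar_matrix_assoc[symmetric]
        scaleR_diff_right scaleR_add_right mult.left_commute)
  have commute: "f X Y = f Y X" for X Y
    by (simp add: f_def inner_commute add.commute)
  have "f (P i) (P j) = 0" if "i \<in> {0..m}" "j \<in> {0..m}" for i j
    using P that by (auto simp: f_def clifford_inner clifford_system_def)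
  then have "f A (P j) = 0" if "j \<in> {0..m}" for j
    using that by (intro linear_eq_0_on_span[OF linear _ A]) auto
  then have "f B A = 0"
    by (intro linear_eq_0_on_span[OF linear _ B]) (auto simp: commute[of _ A])
  then show ?thesis
    by (simp add: f_def inner_commute add.commute)
qed

text \<open>The anticommutator of \<open>B\<close> with itself shows that \<open>B ** B\<close> is a
  scalar matrix. This scalar comes out of the trace of \<open>A ** B ** B ** A\<close>, which is the
  squared norm because \<open>A\<close> and \<open>B\<close> are symmetric.\<close>

lemma clifford_norm_mult:
  fixes P :: "nat \<Rightarrow> real^'n^'n"
  assumes P: "clifford_system m P"
    and A: "A \<in> span (P ` {0..m})" and B: "B \<in> span (P ` {0..m})"
  shows "(norm (A ** B))\<^sup>2 = (norm A)\<^sup>2 * (norm B)\<^sup>2 / CARD('n)"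
proof -
  have "2 *\<^sub>R (B ** B) = 2 *\<^sub>R (((B \<bullet> B) / CARD('n)) *\<^sub>R mat 1)"
    using clifford_anticommutator[OF P B B] by (simp add: scaleR_2)
  then have BB: "B ** B = ((B \<bullet> B) / CARD('n)) *\<^sub>R mat 1"
    by (simp del: scaleR_scaleR)
  have "(norm (A ** B))\<^sup>2 = trace (A ** (B ** B) ** A)"
    by (simp add: power2_norm_eq_inner matrix_inner_eq_trace matrix_transpose_mul
        clifford_transpose[OF P A] clifford_transpose[OF P B] matrix_mul_assoc)
  also have "\<dots> = (B \<bullet> B) / CARD('n) * trace (A ** A)"
    by (simp add: BB matrix_scalar_ac scalar_matrix_assoc[symmetric] trace_scaleR)
  also have "trace (A ** A) = A \<bullet> A"
    by (simp add: matrix_inner_eq_trace clifford_transpose[OF P A])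
  finally show ?thesis by (simp add: power2_norm_eq_inner)
qed

lemma clifford_norm_commutator:
  fixes P :: "nat \<Rightarrow> real^'n^'n"
  assumes P: "clifford_system m P"
    and A: "A \<in> span (P ` {0..m})" and B: "B \<in> span (P ` {0..m})"
  shows "(norm (commutator A B))\<^sup>2
    = 4 / CARD('n) * ((norm A)\<^sup>2 * (norm B)\<^sup>2 - (A \<bullet> B)\<^sup>2)"
proof -
  have "(norm (A ** B - B ** A))\<^sup>2 + (norm (A ** B + B ** A))\<^sup>2
      = 2 * (norm (A ** B))\<^sup>2 + 2 * (norm (B ** A))\<^sup>2"
    by (simp add: power2_norm_eq_inner inner_diff inner_add algebra_simps)
  \<comment> \<open>The squared norm \<open>CARD('n)\<close> of the identity cancels one of the two
    factors in the denominator.\<close>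
  moreover have "(norm (A ** B + B ** A))\<^sup>2 = 4 * (A \<bullet> B)\<^sup>2 / CARD('n)"
    unfolding clifford_anticommutator[OF P A B] power2_norm_eq_inner
    by (simp add: inner_mat_1_self power2_eq_square)
  ultimately show ?thesis
    by (simp add: commutator_def clifford_norm_mult[OF P A B] clifford_norm_mult[OF P B A]
        algebra_simps)
qed

theorem theorem4p3:
  fixes l m M :: nat
    and P :: "nat \<Rightarrow> real^'n^'n"
    and B :: "'k::finite \<Rightarrow> real^'n^'n"
  assumes "l \<ge> 1" and "m \<ge> 1" and "M \<ge> 1"
    and "CARD('n) = 2 * l"
    and "CARD('k) = M"
    and "clifford_system m P"
    and "\<And>r. B r \<in> span (P ` {0..m})"
  shows "let N = min (m + 1) M;
             L = (\<Sum>r\<in>UNIV. \<Sum>s\<in>UNIV. (frob_norm (commutator (B r) (B s)))\<^sup>2);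
             R = 2 / real l * (1 - 1 / real N) * (\<Sum>r\<in>UNIV. (frob_norm (B r))\<^sup>2)\<^sup>2;
             p = (\<lambda>i. (\<chi> r. frob_inner (P i) (B r)) :: real^'k)
         in L \<le> R
          \<and> (m + 1 \<le> M \<longrightarrow>
               (L = R \<longleftrightarrow>
                  (\<forall>i\<in>{0..m}. \<forall>j\<in>{0..m}. i \<noteq> j \<longrightarrow> orthogonal (p i) (p j)) \<and>
                  (\<forall>i\<in>{0..m}. \<forall>j\<in>{0..m}. norm (p i) = norm (p j))))
          \<and> (m + 1 \<ge> M \<longrightarrow>
               (L = R \<longleftrightarrow>
                  (\<forall>r s. r \<noteq> s \<longrightarrow> frob_inner (B r) (B s) = 0) \<and>
                  (\<forall>r s. frob_norm (B r) = frob_norm (B s))))"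
proof -
  define p :: "nat \<Rightarrow> real^'k" where "p i = (\<chi> r. P i \<bullet> B r)" for i
  define S where "S = (\<Sum>r\<in>UNIV. (norm (B r))\<^sup>2)"
  define G where "G = (\<Sum>r\<in>UNIV. \<Sum>s\<in>UNIV. (B r \<bullet> B s)\<^sup>2)"
  define L where "L = (\<Sum>r\<in>UNIV. \<Sum>s\<in>UNIV. (norm (commutator (B r) (B s)))\<^sup>2)"
  define R where "R = 2 / real l * (1 - 1 / real (min (m + 1) M)) * S\<^sup>2"
  have l: "real l > 0" using assms(1) by simp
  have "L = (\<Sum>r\<in>UNIV. \<Sum>s\<in>UNIV. 2 / l * ((norm (B r))\<^sup>2 * (norm (B s))\<^sup>2 - (B r \<bullet> B s)\<^sup>2))"
    unfolding L_def clifford_norm_commutator[OF assms(6,7,7)] assms(4) by simp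
  also have "\<dots> = 2 / l * (S\<^sup>2 - G)"
    unfolding S_def G_def power2_eq_square[of "sum _ _"] sum_product
    by (simp only: sum_distrib_left[symmetric] sum_subtractf)
  finally have L: "L = 2 / l * (S\<^sup>2 - G)" .
  \<comment> \<open>Both the inequality and its equality case now reduce to comparing
    \<open>G\<close> with \<open>S\<^sup>2 / N\<close>, where
    \<open>N = min (m + 1) M\<close>.\<close>
  have RL: "R - L = 2 / l * (G - S\<^sup>2 / real (min (m + 1) M))"
    unfolding R_def L by (simp add: algebra_simps)
  have "2 / real l > 0" using l by simp
  then have sign: "0 \<le> 2 / real l * x \<longleftrightarrow> 0 \<le> x" "2 / real l * x = 0 \<longleftrightarrow> x = 0" for x
    by (simp_all only: zero_le_mult_iff mult_eq_0_iff) auto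
  have le: "L \<le> R \<longleftrightarrow> S\<^sup>2 / real (min (m + 1) M) \<le> G"
    using sign(1)[of "G - S\<^sup>2 / real (min (m + 1) M)"] unfolding RL[symmetric] by linarith
  have eq: "L = R \<longleftrightarrow> G = S\<^sup>2 / real (min (m + 1) M)"
    using sign(2)[of "G - S\<^sup>2 / real (min (m + 1) M)"] unfolding RL[symmetric] by linarith
  have parseval: "A \<bullet> C = (\<Sum>i\<in>{0..m}. (P i \<bullet> A) * (P i \<bullet> C)) / (2 * l)"
    if "A \<in> span (P ` {0..m})" for A C
    using clifford_parseval[OF assms(6) that] assms(4) by simp
  have pp: "p i \<bullet> p j = (\<Sum>r\<in>UNIV. (P i \<bullet> B r) * (P j \<bullet> B r))" for i j
    by (simp add: p_def inner_vec_def)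
  have "S = (\<Sum>r\<in>UNIV. \<Sum>i\<in>{0..m}. (P i \<bullet> B r) * (P i \<bullet> B r)) / (2 * l)"
    unfolding S_def power2_norm_eq_inner parseval[OF assms(7)] sum_divide_distrib ..
  also have "\<dots> = (\<Sum>i\<in>{0..m}. (norm (p i))\<^sup>2) / (2 * l)"
    by (subst sum.swap) (simp add: power2_norm_eq_inner pp)
  finally have S: "S = (\<Sum>i\<in>{0..m}. (norm (p i))\<^sup>2) / (2 * l)" .
  \<comment> \<open>With \<open>a\<close> the matrix of entries \<open>P i \<bullet> B r\<close>,
    this regrouping says that \<open>transpose a ** a\<close> and \<open>a ** transpose a\<close>
    have equal Frobenius norm.\<close>
  have "G = (\<Sum>r\<in>UNIV. \<Sum>s\<in>UNIV. \<Sum>i\<in>{0..m}. \<Sum>j\<in>{0..m}.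
      (P i \<bullet> B r) * (P i \<bullet> B s) * ((P j \<bullet> B r) * (P j \<bullet> B s))) / (2 * l)\<^sup>2"
    unfolding G_def parseval[OF assms(7)] power_divide sum_divide_distrib[symmetric]
    by (simp add: power2_eq_square sum_product)
  also have "(\<Sum>r\<in>UNIV. \<Sum>s\<in>UNIV. \<Sum>i\<in>{0..m}. \<Sum>j\<in>{0..m}.
      (P i \<bullet> B r) * (P i \<bullet> B s) * ((P j \<bullet> B r) * (P j \<bullet> B s)))
    = (\<Sum>i\<in>{0..m}. \<Sum>j\<in>{0..m}. \<Sum>r\<in>UNIV. \<Sum>s\<in>UNIV.
      (P i \<bullet> B r) * (P i \<bullet> B s) * ((P j \<bullet> B r) * (P j \<bullet> B s)))"
    \<comment> \<open>Fixing the index sets orients the swap: sums over \<open>{0..m}\<close> only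
      move outward, so rewriting terminates.\<close>
    by (simp only: sum.swap[of _ "{0..m}" "UNIV :: 'k set"])
  also have "\<dots> = (\<Sum>i\<in>{0..m}. \<Sum>j\<in>{0..m}. (p i \<bullet> p j)\<^sup>2)"
    by (simp add: pp power2_eq_square sum_product mult_ac)
  finally have G: "G = (\<Sum>i\<in>{0..m}. \<Sum>j\<in>{0..m}. (p i \<bullet> p j)\<^sup>2) / (2 * l)\<^sup>2" .
  \<comment> \<open>\<open>S\<^sup>2\<close> and \<open>G\<close> carry the same factor
    \<open>1 / (2 * l)\<^sup>2\<close> relative to the \<open>p i\<close>, so it cancels from the
    comparison; \<open>m + 1\<close> is the cardinality of \<open>{0..m}\<close>.\<close>
  have "(2 * real l)\<^sup>2 > 0" using l by simp
  moreover have "S\<^sup>2 / real (m + 1)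
      = (\<Sum>i\<in>{0..m}. (norm (p i))\<^sup>2)\<^sup>2 / card {0..m} / (2 * real l)\<^sup>2"
    unfolding S by (simp add: power_divide)
  moreover have "G = (\<Sum>i\<in>{0..m}. \<Sum>j\<in>{0..m}. (p i \<bullet> p j)\<^sup>2) / (2 * real l)\<^sup>2"
    using G by simp
  ultimately have le_p: "S\<^sup>2 / real (m + 1) \<le> G"
    and eq_p: "G = S\<^sup>2 / real (m + 1) \<longleftrightarrow>
      (\<forall>i\<in>{0..m}. \<forall>j\<in>{0..m}. i \<noteq> j \<longrightarrow> orthogonal (p i) (p j)) \<and>
      (\<forall>i\<in>{0..m}. \<forall>j\<in>{0..m}. norm (p i) = norm (p j))"
    using gram_norm_bound[of "{0..m}" p]
    by (simp_all only: divide_right_mono less_imp_le divide_cancel_right less_irrefl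
        finite_atLeastAtMost atLeastatMost_empty_iff not_le) auto
  note gram_B = gram_norm_bound[of UNIV B, folded S_def G_def, unfolded assms(5), simplified]
  \<comment> \<open>Both Gram bounds hold for every \<open>m\<close> and \<open>M\<close>; the one
    whose denominator is the minimum gives the estimate and its equality condition. For
    \<open>m + 1 = M\<close> both conditions characterize equality.\<close>
  have "L \<le> R"
    unfolding le using le_p gram_B(1) by (simp add: min_def)
  moreover have "L = R \<longleftrightarrow>
      (\<forall>i\<in>{0..m}. \<forall>j\<in>{0..m}. i \<noteq> j \<longrightarrow> orthogonal (p i) (p j)) \<and>
      (\<forall>i\<in>{0..m}. \<forall>j\<in>{0..m}. norm (p i) = norm (p j))" if "m + 1 \<le> M"
    using eq eq_p that by (simp only: min_absorb1)
  moreover have "L = R \<longleftrightarrow>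
      (\<forall>r s. r \<noteq> s \<longrightarrow> B r \<bullet> B s = 0) \<and> (\<forall>r s. norm (B r) = norm (B s))" if "m + 1 \<ge> M"
    using eq gram_B(2) that by (simp only: min_absorb2 orthogonal_def)
  ultimately show ?thesis
    unfolding Let_def frob_norm_eq_norm frob_inner_eq_inner p_def L_def R_def S_def by blast
qed

end
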